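(* Consider the problem of minimizing $F=(F_1,\dots,F_m)^\top$ over $\mathbf{R}^n$ (setting in the context), let $X^*$ be its set of weakly Pareto optimal points, and assume that $X^*$ is nonempty. Let $x^0\in\operatorname{dom}F$ and $\Omega_F(F(x^0))=\{x\in\mathbf{R}^n : F(x)\le F(x^0)\}$. Assume that for all $x\in\Omega_F(F(x^0))$ there exists $x^*\in X^*$ such that $F(x^* )\le F(x)$, and that $$R:=\sup_{F^*\in F(X^*\cap\Omega_F(F(x^0)))}\ \min_{x\in F^{-1}(\{F^*\})}\|x-x^0\|^2<\infty .$$ Let $\{x^k\}_{k\ge0}$ be a sequence generated by the multiobjective MFISTA algorithm (described in the context) with initial point $x^0$. Then every accumulation point of $\{x^k\}$ is weakly Pareto optimal for the problem of minimizing $F$ over $\mathbf{R}^n$.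
   Context: Problem setting: $F=(F_1,\dots,F_m)^\top$ with $F_i(x)=f_i(x)+g_i(x)$, $i=1,\dots,m$, where $f_i:\mathbf{R}^n\to\mathbf{R}$ is convex and continuously differentiable with Lipschitz continuous gradient of constant $L_i>0$, and $g_i:\mathbf{R}^n\to(-\infty,\infty]$ is closed, proper and convex. Put $L=\max_{i\in\{1,\dots,m\}}L_i$ and $\operatorname{dom}F=\{x\in\mathbf{R}^n : F_i(x)<\infty \text{ for all } i\}$. $\|\cdot\|$ and $\langle\cdot,\cdot\rangle$ are the Euclidean norm and inner product. Vector inequalities $\le$ and $<$ are componentwise. A point $x^*$ is weakly Pareto optimal if there is no $x\in\mathbf{R}^n$ with $F(x)<F(x^* )$. Subproblem solution: for $\ell\ge L$ and given $x,y$, $d_\ell(x,y)$ denotes the unique minimizer $$d_\ell(x,y)=\operatorname*{argmin}_{z\in\mathbf{R}^n}\ \max_{i\in\{1,\ldots,m\}}\Big(\langle\nabla f_i(y),z-y\rangle+g_i(z)+f_i(y)-F_i(x)\Big)+\frac{\ell}{2}\|z-y\|^2 .$$ Multiobjective MFISTA: choose $y^1=x^0\in\operatorname{dom}F$, $t_1=1$, $\ell\ge L$. For $k=1,2,\dots$: (i) $z^k=d_\ell(x^{k-1},y^k)$; (ii) if $\max_{i\in\{1,\dots,m\}}\big(F_i(x^{k-1})-F_i(z^k)\big)\ge 0$ then $x^k=z^k$, otherwise $x^k=x^{k-1}$; (iii) $t_{k+1}=\big(1+\sqrt{1+4t_k^2}\big)/2$; (iv) $y^{k+1}=x^k+\frac{t_k}{t_{k+1}}(z^k-x^k)+\frac{t_k-1}{t_{k+1}}(x^k-x^{k-1})$.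 The practical stopping test (stop once $\|d_\ell(x^{k-1},y^k)-y^k\|<\varepsilon$ for a tolerance $\varepsilon>0$) is disregarded, so that the sequences are infinite. *)

theory Defs
  imports "HOL-Analysis.Analysis"
begin

text \<open>
  Extended-real-valued functions \<open>h : R^n \<rightarrow> (-\<infinity>, \<infinity>]\<close> are rendered as \<^typ>\<open>ereal\<close>-valued
  functions; convexity and closedness are those of the epigraph.
\<close>

definition epi :: "('a \<Rightarrow> ereal) \<Rightarrow> ('a \<times> real) set" where
  "epi h = {(x, r). h x \<le> ereal r}"

definition proper_fun :: "('a \<Rightarrow> ereal) \<Rightarrow> bool" where
  "proper_fun h \<longleftrightarrow> (\<forall>x. h x \<noteq> - \<infinity>) \<and> (\<exists>x. h x \<noteq> \<infinity>)"

definition convex_fun :: "('a::real_vector \<Rightarrow> ereal) \<Rightarrow> bool" where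
  "convex_fun h \<longleftrightarrow> convex (epi h)"

definition closed_fun :: "('a::topological_space \<Rightarrow> ereal) \<Rightarrow> bool" where
  "closed_fun h \<longleftrightarrow> closed (epi h)"

text \<open>
  Vector-valued objectives have type \<open>'a \<Rightarrow> 'm \<Rightarrow> ereal\<close>, so that \<open>F x \<le> F y\<close> is the
  componentwise order. The strict componentwise order has to be spelled out, since
  \<open>F x < F y\<close> on functions only means \<open>F x \<le> F y\<close> and \<open>F x \<noteq> F y\<close>.
\<close>

definition effective_dom :: "('a \<Rightarrow> 'm \<Rightarrow> ereal) \<Rightarrow> 'a set" where
  "effective_dom F = {x. \<forall>i. F x i < \<infinity>}"

definition weakly_pareto :: "('a \<Rightarrow> 'm \<Rightarrow> ereal) \<Rightarrow> 'a set" where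
  "weakly_pareto F = {xs. \<not> (\<exists>x. \<forall>i. F x i < F xs i)}"

definition level_set :: "('a \<Rightarrow> 'm \<Rightarrow> ereal) \<Rightarrow> ('m \<Rightarrow> ereal) \<Rightarrow> 'a set" where
  "level_set F c = {x. F x \<le> c}"

text \<open>
  The constant \<open>R\<close>, as an extended real. The inner minimum is written as an infimum, with
  which it agrees whenever it is attained.
\<close>

definition pareto_radius :: "('a::real_normed_vector \<Rightarrow> 'm \<Rightarrow> ereal) \<Rightarrow> 'a \<Rightarrow> ereal" where
  "pareto_radius F x0 =
     (SUP Fs \<in> F ` (weakly_pareto F \<inter> level_set F (F x0)).
        INF x \<in> F -` {Fs}. ereal ((norm (x - x0))\<^sup>2))"

definition composite :: "('m \<Rightarrow> 'a \<Rightarrow> real) \<Rightarrow> ('m \<Rightarrow> 'a \<Rightarrow> ereal) \<Rightarrow> 'a \<Rightarrow> 'm \<Rightarrow> ereal" where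
  "composite f g x i = ereal (f i x) + g i x"

text \<open>In the following, \<open>df i\<close> stands for the gradient of \<open>f i\<close>.\<close>

definition subproblem ::
  "('m::finite \<Rightarrow> 'a::real_inner \<Rightarrow> real) \<Rightarrow> ('m \<Rightarrow> 'a \<Rightarrow> 'a) \<Rightarrow> ('m \<Rightarrow> 'a \<Rightarrow> ereal)
     \<Rightarrow> real \<Rightarrow> 'a \<Rightarrow> 'a \<Rightarrow> 'a \<Rightarrow> ereal" where
  "subproblem f df g l x y z =
     (MAX i. ereal (inner (df i y) (z - y)) + g i z + ereal (f i y) - composite f g x i)
       + ereal (l / 2 * (norm (z - y))\<^sup>2)"

definition subproblem_sol ::
  "('m::finite \<Rightarrow> 'a::real_inner \<Rightarrow> real) \<Rightarrow> ('m \<Rightarrow> 'a \<Rightarrow> 'a) \<Rightarrow> ('m \<Rightarrow> 'a \<Rightarrow> ereal)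
     \<Rightarrow> real \<Rightarrow> 'a \<Rightarrow> 'a \<Rightarrow> 'a" where
  "subproblem_sol f df g l x y = arg_min (subproblem f df g l x y) (\<lambda>_. True)"

text \<open>The values \<open>y 0\<close>, \<open>z 0\<close> and \<open>t 0\<close> play no role: these sequences start at index \<open>1\<close>.\<close>

definition mfista ::
  "('m::finite \<Rightarrow> 'a::real_inner \<Rightarrow> real) \<Rightarrow> ('m \<Rightarrow> 'a \<Rightarrow> 'a) \<Rightarrow> ('m \<Rightarrow> 'a \<Rightarrow> ereal)
     \<Rightarrow> real \<Rightarrow> 'a \<Rightarrow> (nat \<Rightarrow> 'a) \<Rightarrow> (nat \<Rightarrow> 'a) \<Rightarrow> (nat \<Rightarrow> 'a) \<Rightarrow> (nat \<Rightarrow> real) \<Rightarrow> bool" where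
  "mfista f df g l x0 x y z t \<longleftrightarrow>
     x 0 = x0 \<and> y 1 = x0 \<and> t 1 = 1 \<and>
     (\<forall>k\<ge>1.
        z k = subproblem_sol f df g l (x (k - 1)) (y k) \<and>
        x k = (if (MAX i. composite f g (x (k - 1)) i - composite f g (z k) i) \<ge> 0
               then z k else x (k - 1)) \<and>
        t (k + 1) = (1 + sqrt (1 + 4 * (t k)\<^sup>2)) / 2 \<and>
        y (k + 1) = x k + (t k / t (k + 1)) *\<^sub>R (z k - x k)
                        + ((t k - 1) / t (k + 1)) *\<^sub>R (x k - x (k - 1)))"

definition accumulation_point :: "(nat \<Rightarrow> 'a::topological_space) \<Rightarrow> 'a \<Rightarrow> bool" where
  "accumulation_point x p \<longleftrightarrow> (\<exists>r. strict_mono r \<and> (x \<circ> r) \<longlonglongrightarrow> p)"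

end

theory Submission
  imports Defs
begin

text \<open>
  For \<open>u\<close> in the domain put \<open>\<sigma>\<^sub>k(u) = min\<^sub>i (F\<^sub>i(x\<^sup>k) - F\<^sub>i(u))\<close>. The acceptance test makes
  \<open>\<sigma>\<^sub>k(u) \<le> \<sigma>\<^sub>k\<^sub>-\<^sub>1(u) + max\<^sub>i (F\<^sub>i(z\<^sup>k) - F\<^sub>i(x\<^sup>k\<^sup>-\<^sup>1))\<close> hold in either branch: a rejected \<open>z\<^sup>k\<close> is
  worse in every component, so that the added maximum is positive. Bounding that maximum by the
  strong convexity of the subproblem, once at \<open>u\<close> and once at \<open>x\<^sup>k\<^sup>-\<^sup>1\<close>, gives the usual FISTA
  telescoping and \<open>t\<^sub>k\<^sup>2 \<sigma>\<^sub>k(u) \<le> l/2 \<parallel>u - x\<^sup>0\<parallel>\<^sup>2\<close> for every such \<open>u\<close>.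
  If \<open>F(u) < F(p)\<close> at an accumulation point \<open>p\<close>, lower semicontinuity keeps \<open>\<sigma>\<^sub>k(u)\<close> bounded away
  from \<open>0\<close> along a subsequence, which contradicts \<open>t\<^sub>k \<rightarrow> \<infinity>\<close>.
\<close>

section \<open>Closed and strongly convex functions\<close>

lemma closed_fun_sublevel:
  assumes "closed_fun h"
  shows "closed {x. h x \<le> ereal r}"
proof -
  have "closed ((\<lambda>x. (x, r)) -` epi h)"
    using assms by (intro closed_vimage) (auto simp: closed_fun_def intro!: continuous_intros)
  then show ?thesis by (simp add: epi_def vimage_def)
qed

text \<open>Finite intersection property for the sublevel sets of \<open>h\<close> at the real
  levels above the infimum; this also covers an infimum of \<open>- \<infinity>\<close> or
  \<open>\<infinity>\<close>.\<close>

lemma closed_fun_attains_inf: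
  assumes "closed_fun h" "compact K" "K \<noteq> {}"
  shows "\<exists>w\<in>K. \<forall>u\<in>K. h w \<le> h u"
proof -
  define m where "m = (INF u\<in>K. h u)"
  define I where "I = {r. m < ereal r}"
  have "K \<inter> (\<Inter>r\<in>I. {x. h x \<le> ereal r}) \<noteq> {}"
  proof (rule compact_imp_fip_image[OF assms(2)])
    fix J assume J: "finite J" "J \<subseteq> I"
    show "K \<inter> (\<Inter>r\<in>J. {x. h x \<le> ereal r}) \<noteq> {}"
    proof (cases "J = {}")
      case False
      then have "m < ereal (Min J)" using J Min_in by (auto simp: I_def)
      then obtain u where u: "u \<in> K" "h u < ereal (Min J)"
        unfolding m_def by (auto simp: INF_less_iff)
      have "h u \<le> ereal r" if "r \<in> J" for r
        using u(2) Min_le[OF J(1) that] by (meson ereal_less_eq(3) less_imp_le order_trans)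
      with u(1) show ?thesis by auto
    qed (use assms in auto)
  qed (use closed_fun_sublevel[OF assms(1)] in auto)
  then obtain w where w: "w \<in> K" "\<And>r. m < ereal r \<Longrightarrow> h w \<le> ereal r" by (auto simp: I_def)
  have "h w \<le> m"
  proof (rule ccontr)
    assume "\<not> h w \<le> m"
    then obtain r where "m < ereal r" "ereal r < h w" using ereal_dense2[of m "h w"] by (auto simp: not_le)
    with w(2) show False by (meson leD)
  qed
  then show ?thesis using w(1) unfolding m_def by (meson INF_lower order_trans)
qed

text \<open>Adding \<open>a\<close> shears the epigraph, so the new epigraph is a continuous
  preimage of \<open>epi g\<close>.\<close>

lemma closed_fun_add_continuous:
  fixes a :: "'a::topological_space \<Rightarrow> real"
  assumes "closed_fun g" "continuous_on UNIV a"
  shows "closed_fun (\<lambda>u. ereal (a u) + g u)"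
proof -
  have eq: "epi (\<lambda>u. ereal (a u) + g u) = (\<lambda>(u, r). (u, r - a u)) -` epi g"
  proof -
    have "ereal (a u) + g u \<le> ereal r \<longleftrightarrow> g u \<le> ereal (r - a u)" for u r
      by (cases "g u") auto
    then show ?thesis by (auto simp: epi_def)
  qed
  have "continuous_on UNIV (\<lambda>(u, r). (u, r - a u))"
    unfolding split_def
    by (intro continuous_intros continuous_on_compose2[OF assms(2)]) auto
  then show ?thesis
    using assms(1) by (simp add: closed_fun_def eq closed_vimage)
qed

lemma closed_fun_Max:
  fixes h :: "'i::finite \<Rightarrow> 'a::topological_space \<Rightarrow> ereal"
  assumes "\<And>i. closed_fun (h i)"
  shows "closed_fun (\<lambda>u. MAX i. h i u)"
proof -
  have "epi (\<lambda>u. MAX i. h i u) = (\<Inter>i. epi (h i))"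
    by (auto simp: epi_def)
  then show ?thesis using assms by (auto simp: closed_fun_def)
qed

text \<open>Real upper bounds \<open>r\<close>, \<open>q\<close> in place of the values of \<open>h\<close> avoid \<open>\<infinity> - \<infinity>\<close> and \<open>0 * \<infinity>\<close>.\<close>

definition strongly_convex_fun :: "real \<Rightarrow> ('a::real_normed_vector \<Rightarrow> ereal) \<Rightarrow> bool" where
  "strongly_convex_fun c h \<longleftrightarrow>
     (\<forall>u v r q s. h u \<le> ereal r \<longrightarrow> h v \<le> ereal q \<longrightarrow> 0 \<le> s \<longrightarrow> s \<le> 1 \<longrightarrow>
        h ((1 - s) *\<^sub>R u + s *\<^sub>R v) \<le> ereal ((1 - s) * r + s * q - c * s * (1 - s) * (norm (u - v))\<^sup>2))"

lemma strongly_convex_funD: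
  assumes "strongly_convex_fun c h" "h u \<le> ereal r" "h v \<le> ereal q" "0 \<le> s" "s \<le> 1"
  shows "h ((1 - s) *\<^sub>R u + s *\<^sub>R v) \<le> ereal ((1 - s) * r + s * q - c * s * (1 - s) * (norm (u - v))\<^sup>2)"
  using assms unfolding strongly_convex_fun_def by blast

lemma strongly_convex_fun_Max:
  fixes h :: "'i::finite \<Rightarrow> 'a::real_normed_vector \<Rightarrow> ereal"
  assumes "\<And>i. strongly_convex_fun c (h i)"
  shows "strongly_convex_fun c (\<lambda>u. MAX i. h i u)"
  unfolding strongly_convex_fun_def
  using strongly_convex_funD[OF assms] by (auto simp: Max_le_iff)

text \<open>The affine part interpolates exactly along a segment, and
  \<open>c * (norm (u - y))\<^sup>2\<close> falls short of its interpolation by exactly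
  \<open>c * s * (1 - s) * (norm (u - v))\<^sup>2\<close>; convexity of \<open>g\<close> does the
  rest.\<close>

lemma strongly_convex_fun_add_quadratic:
  fixes g :: "'a::real_inner \<Rightarrow> ereal"
  assumes "convex_fun g"
  shows "strongly_convex_fun c (\<lambda>u. ereal (inner b u + d + c * (norm (u - y))\<^sup>2) + g u)"
  unfolding strongly_convex_fun_def
proof (intro allI impI)
  let ?a = "\<lambda>u. inner b u + d + c * (norm (u - y))\<^sup>2"
  fix u v r q and s :: real
  assume le: "ereal (?a u) + g u \<le> ereal r" "ereal (?a v) + g v \<le> ereal q" and s: "0 \<le> s" "s \<le> 1"
  let ?w = "(1 - s) *\<^sub>R u + s *\<^sub>R v"
  have shift: "ereal (?a x) + g x \<le> ereal e \<longleftrightarrow> g x \<le> ereal (e - ?a x)" for x e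
    by (cases "g x") auto
  have "(u, r - ?a u) \<in> epi g" "(v, q - ?a v) \<in> epi g"
    using le by (auto simp: epi_def shift)
  then have "(1 - s) *\<^sub>R (u, r - ?a u) + s *\<^sub>R (v, q - ?a v) \<in> epi g"
    using assms s unfolding convex_fun_def by (intro convexD) auto
  then have "g ?w \<le> ereal ((1 - s) * (r - ?a u) + s * (q - ?a v))"
    by (simp add: epi_def)
  also have "(1 - s) * (r - ?a u) + s * (q - ?a v)
      = ((1 - s) * r + s * q - c * s * (1 - s) * (norm (u - v))\<^sup>2) - ?a ?w"
    unfolding power2_norm_eq_inner
    by (simp add: inner_simps inner_commute algebra_simps)
  finally show "ereal (?a ?w) + g ?w
      \<le> ereal ((1 - s) * r + s * q - c * s * (1 - s) * (norm (u - v))\<^sup>2)"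
    unfolding shift .
qed

text \<open>Strong convexity alone makes the sublevel set \<open>K\<close> through \<open>a\<close>
  bounded: a lower bound \<open>m\<close> on the unit ball around \<open>a\<close> limits how far
  \<open>K\<close> can extend. Attainment on the compact set \<open>K\<close> then gives a global
  minimizer.\<close>

lemma strongly_convex_fun_minimizer_exists:
  fixes h :: "'a::euclidean_space \<Rightarrow> ereal"
  assumes cl: "closed_fun h" and sc: "strongly_convex_fun c h" and c: "c > 0"
    and bot: "\<And>u. h u \<noteq> - \<infinity>" and a: "h a \<noteq> \<infinity>"
  shows "\<exists>w. \<forall>u. h w \<le> h u"
proof -
  obtain q where q: "h a = ereal q" using a bot[of a] by (cases "h a") auto
  obtain w0 where w0: "w0 \<in> cball a 1" "\<And>u. u \<in> cball a 1 \<Longrightarrow> h w0 \<le> h u"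
    using closed_fun_attains_inf[OF cl compact_cball[of a 1]] by auto
  have "h w0 \<le> ereal q" using w0(2)[of a] q by simp
  then obtain m where m: "h w0 = ereal m" using bot[of w0] by (cases "h w0") auto
  define K where "K = {u. h u \<le> ereal q}"
  have "norm (u - a) \<le> 1 + (q - m) / c" if "u \<in> K" for u
  proof (cases "norm (u - a) \<le> 1")
    case True
    then show ?thesis using \<open>h w0 \<le> ereal q\<close> m c by (simp add: add_increasing2)
  next
    case False
    define n where "n = norm (u - a)"
    have n: "n > 1" using False by (simp add: n_def)
    \<comment> \<open>The point where the segment from \<open>a\<close> to \<open>u\<close> crosses
      the unit sphere around \<open>a\<close>. There \<open>h\<close> is at least \<open>m\<close>,
      while strong convexity bounds it by \<open>q - c * (n - 1)\<close>.\<close>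
    let ?w = "(1 - 1 / n) *\<^sub>R a + (1 / n) *\<^sub>R u"
    have "?w - a = (1 / n) *\<^sub>R (u - a)" by (simp add: algebra_simps)
    then have "norm (?w - a) = norm ((1 / n) *\<^sub>R (u - a))" by (rule arg_cong)
    also have "\<dots> = 1" using n by (simp flip: n_def)
    finally have "norm (?w - a) = 1" .
    then have "ereal m \<le> h ?w" using w0(2)[of ?w] m by (simp add: dist_norm norm_minus_commute)
    also have "\<dots> \<le> ereal ((1 - 1 / n) * q + 1 / n * q - c * (1 / n) * (1 - 1 / n) * (norm (a - u))\<^sup>2)"
      using that q n by (intro strongly_convex_funD[OF sc]) (auto simp: K_def)
    also have "norm (a - u) = n" by (simp add: n_def norm_minus_commute)
    also have "(1 - 1 / n) * q + 1 / n * q - c * (1 / n) * (1 - 1 / n) * n\<^sup>2 = q - c * (n - 1)"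
      using n by (simp add: field_simps power2_eq_square)
    finally show ?thesis using c by (simp add: n_def field_simps)
  qed
  then have "bounded K" unfolding bounded_def by (metis dist_norm norm_minus_commute)
  then have "compact K"
    using closed_fun_sublevel[OF cl] by (simp add: K_def compact_eq_bounded_closed)
  moreover have aK: "a \<in> K" by (simp add: K_def q)
  ultimately obtain w where w: "w \<in> K" "\<And>u. u \<in> K \<Longrightarrow> h w \<le> h u"
    using closed_fun_attains_inf[OF cl, of K] by (metis empty_iff)
  have "h w \<le> h u" for u
    using w by (cases "u \<in> K") (auto simp: K_def)
  then show ?thesis by blast
qed

lemma strongly_convex_fun_growth:
  assumes sc: "strongly_convex_fun c h" and bot: "\<And>u. h u \<noteq> - \<infinity>" and w: "\<And>u. h w \<le> h u"
  shows "h w + ereal (c * (norm (u - w))\<^sup>2) \<le> h u"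
proof (cases "h u")
  case (real q)
  obtain r where r: "h w = ereal r" using w[of u] bot[of w] real by (cases "h w") auto
  have "c * (norm (u - w))\<^sup>2 \<le> q - r"
  \<comment> \<open>Minimality of \<open>w\<close> is compared with strong convexity at the point
    with weight \<open>e\<close> on \<open>w\<close>; dividing by \<open>1 - e\<close> and letting
    \<open>e\<close> tend to 1 gives the full constant \<open>c\<close>.\<close>
  proof (rule field_le_mult_one_interval)
    fix e :: real assume e: "0 < e" "e < 1"
    let ?v = "(1 - (1 - e)) *\<^sub>R w + (1 - e) *\<^sub>R u"
    have "ereal r \<le> h ?v" using w r by metis
    also have "\<dots> \<le> ereal ((1 - (1 - e)) * r + (1 - e) * q - c * (1 - e) * (1 - (1 - e)) * (norm (w - u))\<^sup>2)"
      using r real e by (intro strongly_convex_funD[OF sc]) auto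
    finally have "(1 - e) * (e * (c * (norm (u - w))\<^sup>2)) \<le> (1 - e) * (q - r)"
      by (simp add: algebra_simps norm_minus_commute)
    then show "e * (c * (norm (u - w))\<^sup>2) \<le> q - r" using e by simp
  qed
  then show ?thesis by (simp add: r real)
qed (use bot in auto)

section \<open>First-order bounds for the smooth part\<close>

lemma GDERIV_along_line:
  assumes "\<And>u. GDERIV \<phi> u :> d\<phi> u"
  shows "((\<lambda>s. \<phi> (y + s *\<^sub>R v)) has_real_derivative inner (d\<phi> (y + s *\<^sub>R v)) v) (at s within S)"
proof -
  have "((\<lambda>s. y + s *\<^sub>R v) has_derivative (\<lambda>s. s *\<^sub>R v)) (at s within S)"
    by (auto intro!: derivative_eq_intros)
  then have "((\<lambda>s. \<phi> (y + s *\<^sub>R v)) has_derivative (\<lambda>e. inner (e *\<^sub>R v) (d\<phi> (y + s *\<^sub>R v)))) (at s within S)"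
    using assms[of "y + s *\<^sub>R v"] unfolding gderiv_def
    by (rule has_derivative_compose)
  then show ?thesis by (simp add: has_field_derivative_def inner_commute mult_commute_abs)
qed

lemma descent_lemma:
  assumes d: "\<And>u. GDERIV \<phi> u :> d\<phi> u" and lip: "L-lipschitz_on UNIV d\<phi>"
  shows "\<phi> z \<le> \<phi> y + inner (d\<phi> y) (z - y) + L / 2 * (norm (z - y))\<^sup>2"
proof -
  define v where "v = z - y"
  \<comment> \<open>The claim is \<open>?p 1 \<le> ?p 0\<close>. The derivative of \<open>?p\<close>
    is nonpositive on the unit interval by Cauchy-Schwarz and the Lipschitz bound.\<close>
  let ?p = "\<lambda>s. \<phi> (y + s *\<^sub>R v) - s * inner (d\<phi> y) v - L / 2 * s\<^sup>2 * (norm v)\<^sup>2"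
  have "?p 1 \<le> ?p 0"
  proof (rule DERIV_nonpos_imp_nonincreasing[of 0 1 ?p])
    fix s :: real assume s: "0 \<le> s" "s \<le> 1"
    let ?D = "inner (d\<phi> (y + s *\<^sub>R v)) v - inner (d\<phi> y) v - L * s * (norm v)\<^sup>2"
    have "DERIV ?p s :> ?D"
      by (rule derivative_eq_intros GDERIV_along_line[OF d] refl | simp)+
    moreover have "?D \<le> 0"
    proof -
      have "inner (d\<phi> (y + s *\<^sub>R v) - d\<phi> y) v \<le> norm (d\<phi> (y + s *\<^sub>R v) - d\<phi> y) * norm v"
        by (rule norm_cauchy_schwarz)
      also have "\<dots> \<le> (L * norm (s *\<^sub>R v)) * norm v"
        using lipschitz_onD[OF lip, of "y + s *\<^sub>R v" y] by (intro mult_right_mono) (auto simp: dist_norm)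
      finally show ?thesis using s by (simp add: inner_diff_left power2_eq_square algebra_simps)
    qed
    ultimately show "\<exists>D. DERIV ?p s :> D \<and> D \<le> 0" by blast
  qed simp
  then show ?thesis by (simp add: v_def)
qed

lemma convex_above_tangent:
  assumes d: "\<And>u. GDERIV \<phi> u :> d\<phi> u" and cvx: "convex_on UNIV \<phi>"
  shows "\<phi> y + inner (d\<phi> y) (u - y) \<le> \<phi> u"
proof -
  have "convex_on UNIV (\<lambda>s::real. \<phi> (y + s *\<^sub>R (u - y)))"
  proof (rule convex_onI)
    fix e a b :: real assume e: "0 < e" "e < 1"
    have "y + ((1 - e) *\<^sub>R a + e *\<^sub>R b) *\<^sub>R (u - y)
        = (1 - e) *\<^sub>R (y + a *\<^sub>R (u - y)) + e *\<^sub>R (y + b *\<^sub>R (u - y))"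
      by (simp add: algebra_simps)
    then show "\<phi> (y + ((1 - e) *\<^sub>R a + e *\<^sub>R b) *\<^sub>R (u - y))
        \<le> (1 - e) * \<phi> (y + a *\<^sub>R (u - y)) + e * \<phi> (y + b *\<^sub>R (u - y))"
      using convex_onD[OF cvx, of e] e by simp
  qed simp
  from convex_on_imp_above_tangent[OF this, of 0 1, OF _ _ _ GDERIV_along_line[OF d]]
  show ?thesis by simp
qed

section \<open>One step of the algorithm\<close>

text \<open>Passage from \<open>ereal\<close> to \<open>real\<close>: on the domain all values are
  finite, so later estimates are plain real arithmetic.\<close>

lemma effective_domD:
  assumes "\<And>i. proper_fun (g i)" "u \<in> effective_dom (composite f g)"
  shows "composite f g u i = ereal (real_of_ereal (composite f g u i))"
    and "g i u = ereal (real_of_ereal (composite f g u i) - f i u)"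
proof -
  have "g i u \<noteq> - \<infinity>" "ereal (f i u) + g i u < \<infinity>"
    using assms unfolding proper_fun_def effective_dom_def composite_def by blast+
  then show "composite f g u i = ereal (real_of_ereal (composite f g u i))"
    and "g i u = ereal (real_of_ereal (composite f g u i) - f i u)"
    unfolding composite_def by (cases "g i u"; simp)+
qed

lemma Max_ereal_image:
  fixes a :: "'i::finite \<Rightarrow> real"
  shows "(MAX i. ereal (a i)) = ereal (MAX i. a i)"
  using mono_Max_commute[of ereal "range a"] by (simp add: mono_def image_image)

lemma Min_range_attained:
  fixes a :: "'i::finite \<Rightarrow> 'b::linorder"
  shows "\<exists>j. (MIN i. a i) = a j"
proof -
  have "(MIN i. a i) \<in> range a" by (rule Min_in) auto
  then show ?thesis by (rule imageE) blast
qed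

section \<open>The subproblem: strong convexity, minimizer and decrease inequality\<close>

context
  fixes f :: "'m::finite \<Rightarrow> 'a::euclidean_space \<Rightarrow> real"
    and df :: "'m \<Rightarrow> 'a \<Rightarrow> 'a" and g :: "'m \<Rightarrow> 'a \<Rightarrow> ereal"
    and l :: real and x y :: 'a
  assumes f_convex: "\<And>i. convex_on UNIV (f i)"
    and f_grad: "\<And>i u. GDERIV (f i) u :> df i u"
    and df_lipschitz: "\<And>i. l-lipschitz_on UNIV (df i)"
    and l_pos: "l > 0"
    and g_closed: "\<And>i. closed_fun (g i)"
    and g_proper: "\<And>i. proper_fun (g i)"
    and g_convex: "\<And>i. convex_fun (g i)"
    and x_dom: "x \<in> effective_dom (composite f g)"
begin

text \<open>Moving the quadratic inside the maximum turns each component into affine plus quadratic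
  plus \<open>g i\<close>, the shape to which the closedness and strong convexity lemmas
  apply.\<close>

lemma subproblem_eq_Max:
  "subproblem f df g l x y =
     (\<lambda>u. MAX i. ereal (inner (df i y) u
         + (f i y - inner (df i y) y - real_of_ereal (composite f g x i))
         + l / 2 * (norm (u - y))\<^sup>2) + g i u)"
proof
  fix u
  let ?h = "\<lambda>i. ereal (inner (df i y) (u - y)) + g i u + ereal (f i y) - composite f g x i"
  let ?q = "ereal (l / 2 * (norm (u - y))\<^sup>2)"
  have "(MAX i. ?h i) + ?q = (MAX i. ?h i + ?q)"
    using mono_Max_commute[of "\<lambda>e. e + ?q" "range ?h"]
    by (simp add: mono_def add_right_mono image_image)
  moreover have "(\<lambda>i. ?h i + ?q) = (\<lambda>i. ereal (inner (df i y) u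
         + (f i y - inner (df i y) y - real_of_ereal (composite f g x i))
         + l / 2 * (norm (u - y))\<^sup>2) + g i u)"
  proof
    fix i
    obtain e where e: "composite f g x i = ereal e"
      using effective_domD(1)[OF g_proper x_dom] by metis
    show "?h i + ?q = ereal (inner (df i y) u
         + (f i y - inner (df i y) y - real_of_ereal (composite f g x i))
         + l / 2 * (norm (u - y))\<^sup>2) + g i u"
      by (cases "g i u") (simp_all add: e inner_diff_right)
  qed
  ultimately show "subproblem f df g l x y u = (MAX i. ereal (inner (df i y) u
         + (f i y - inner (df i y) y - real_of_ereal (composite f g x i))
         + l / 2 * (norm (u - y))\<^sup>2) + g i u)"
    unfolding subproblem_def by (simp only:)
qed

text \<open>Replacing \<open>g i u\<close> by \<open>F_i(u) - f_i(u)\<close> exposes the objective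
  difference \<open>F_i(u) - F_i(x)\<close> plus a linearization error of
  \<open>f i\<close>.\<close>

lemma subproblem_on_dom:
  assumes "u \<in> effective_dom (composite f g)"
  shows "subproblem f df g l x y u = ereal (MAX i. inner (df i y) (u - y) + f i y - f i u
     + real_of_ereal (composite f g u i) - real_of_ereal (composite f g x i)
     + l / 2 * (norm (u - y))\<^sup>2)"
proof -
  have "ereal (inner (df i y) u + (f i y - inner (df i y) y - real_of_ereal (composite f g x i))
         + l / 2 * (norm (u - y))\<^sup>2) + g i u
     = ereal (inner (df i y) (u - y) + f i y - f i u
     + real_of_ereal (composite f g u i) - real_of_ereal (composite f g x i)
     + l / 2 * (norm (u - y))\<^sup>2)" for i
    by (subst effective_domD(2)[OF g_proper assms]) (simp add: inner_diff_right)
  then show ?thesis unfolding subproblem_eq_Max by (simp only: Max_ereal_image)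
qed

lemma subproblem_not_MInf: "subproblem f df g l x y u \<noteq> - \<infinity>"
proof -
  have "ereal e + g i u > - \<infinity>" for e i
    using g_proper[of i] by (cases "g i u") (auto simp: proper_fun_def)
  then have "subproblem f df g l x y u > - \<infinity>"
    unfolding subproblem_eq_Max by (subst Max_gr_iff) auto
  then show ?thesis by simp
qed

lemma strongly_convex_subproblem: "strongly_convex_fun (l / 2) (subproblem f df g l x y)"
  unfolding subproblem_eq_Max
  by (intro strongly_convex_fun_Max strongly_convex_fun_add_quadratic g_convex)

text \<open>\<open>arg_min\<close> is a choice operator, so a minimizer has to be exhibited before
  its value is known to minimize.\<close>

lemma subproblem_sol_le: "subproblem f df g l x y (subproblem_sol f df g l x y) \<le> subproblem f df g l x y u"
proof -
  have "closed_fun (subproblem f df g l x y)"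
    unfolding subproblem_eq_Max
    by (intro closed_fun_Max closed_fun_add_continuous g_closed continuous_intros)
  then obtain w where "\<And>u. subproblem f df g l x y w \<le> subproblem f df g l x y u"
    using strongly_convex_fun_minimizer_exists[OF _ strongly_convex_subproblem _ subproblem_not_MInf, of x]
      subproblem_on_dom[OF x_dom] l_pos by auto
  then have "is_arg_min (subproblem f df g l x y) (\<lambda>_. True) w"
    by (simp add: is_arg_min_linorder)
  then have "is_arg_min (subproblem f df g l x y) (\<lambda>_. True) (subproblem_sol f df g l x y)"
    unfolding subproblem_sol_def arg_min_def by (rule someI)
  then show ?thesis by (simp add: is_arg_min_linorder)
qed

lemma subproblem_sol_in_dom: "subproblem_sol f df g l x y \<in> effective_dom (composite f g)"
proof -
  have "subproblem f df g l x y (subproblem_sol f df g l x y) < \<infinity>"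
    using subproblem_sol_le[of x] subproblem_on_dom[OF x_dom] by auto
  then have "ereal e + g i (subproblem_sol f df g l x y) < \<infinity>"
    if "e = inner (df i y) (subproblem_sol f df g l x y)
         + (f i y - inner (df i y) y - real_of_ereal (composite f g x i))
         + l / 2 * (norm (subproblem_sol f df g l x y - y))\<^sup>2" for e i
    unfolding subproblem_eq_Max that by (subst (asm) Max_less_iff) auto
  then have "g i (subproblem_sol f df g l x y) < \<infinity>" for i
    by fastforce
  then show ?thesis by (auto simp: effective_dom_def composite_def)
qed

text \<open>Quadratic growth of the model at its minimizer \<open>z\<close>, with the model replaced
  by true objective differences: the descent lemma bounds it from below at \<open>z\<close>, the
  tangent inequality from above at \<open>u\<close>.\<close>

lemma subproblem_sol_decrease:
  assumes u: "u \<in> effective_dom (composite f g)"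
  defines "z \<equiv> subproblem_sol f df g l x y"
  shows "(MAX i. real_of_ereal (composite f g z i) - real_of_ereal (composite f g x i))
       + l / 2 * (norm (u - z))\<^sup>2
     \<le> (MAX i. real_of_ereal (composite f g u i) - real_of_ereal (composite f g x i))
       + l / 2 * (norm (u - y))\<^sup>2"
proof -
  let ?v = "\<lambda>u i. real_of_ereal (composite f g u i) - real_of_ereal (composite f g x i)"
  let ?s = "\<lambda>u i. inner (df i y) (u - y) + f i y - f i u
     + real_of_ereal (composite f g u i) - real_of_ereal (composite f g x i) + l / 2 * (norm (u - y))\<^sup>2"
  have z: "z \<in> effective_dom (composite f g)"
    unfolding z_def by (rule subproblem_sol_in_dom)
  have "ereal (Max (range (?s z))) + ereal (l / 2 * (norm (u - z))\<^sup>2) \<le> ereal (Max (range (?s u)))"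
    using strongly_convex_fun_growth[OF strongly_convex_subproblem subproblem_not_MInf subproblem_sol_le, of u]
    unfolding z_def[symmetric] subproblem_on_dom[OF z] subproblem_on_dom[OF u] .
  then have "Max (range (?s z)) + l / 2 * (norm (u - z))\<^sup>2 \<le> Max (range (?s u))" by simp
  moreover have "Max (range (?v z)) \<le> Max (range (?s z))"
  proof (intro Max.boundedI)
    fix e assume "e \<in> range (?v z)"
    then obtain i where "e = ?v z i" by blast
    also have "\<dots> \<le> ?s z i"
      using descent_lemma[OF f_grad df_lipschitz, of i z y] by (simp add: algebra_simps)
    also have "\<dots> \<le> Max (range (?s z))" by simp
    finally show "e \<le> Max (range (?s z))" .
  qed auto
  moreover have "Max (range (?s u)) \<le> Max (range (?v u)) + l / 2 * (norm (u - y))\<^sup>2"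
  proof (intro Max.boundedI)
    fix e assume "e \<in> range (?s u)"
    then obtain i where "e = ?s u i" by blast
    also have "\<dots> \<le> ?v u i + l / 2 * (norm (u - y))\<^sup>2"
      using convex_above_tangent[OF f_grad f_convex, of i y u] by simp
    also have "?v u i \<le> Max (range (?v u))" by (rule Max_ge) auto
    finally show "e \<le> Max (range (?v u)) + l / 2 * (norm (u - y))\<^sup>2" by simp
  qed auto
  ultimately show ?thesis by linarith
qed

end

section \<open>Convergence rate\<close>

text \<open>As functions of \<open>w\<close>, \<open>t * (t - 1) * (norm (x - w))\<^sup>2 + t *
  (norm (u - w))\<^sup>2\<close> and
  \<open>(norm (t *\<^sub>R w - (t - 1) *\<^sub>R x - u))\<^sup>2\<close> have the same quadratic
  and linear terms, so their increments between \<open>z\<close> and \<open>y\<close> agree.\<close>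

lemma fista_identity:
  fixes x y z u :: "'a::real_inner"
  shows "t * (t - 1) * ((norm (x - y))\<^sup>2 - (norm (x - z))\<^sup>2) + t * ((norm (u - y))\<^sup>2 - (norm (u - z))\<^sup>2)
     = (norm (t *\<^sub>R y - (t - 1) *\<^sub>R x - u))\<^sup>2 - (norm (t *\<^sub>R z - (t - 1) *\<^sub>R x - u))\<^sup>2"
  unfolding power2_norm_eq_inner
  by (simp add: inner_simps inner_commute algebra_simps power2_eq_square)

text \<open>\<open>t (k + 1)\<close> is the positive root of
  \<open>s\<^sup>2 - s = (t k)\<^sup>2\<close>, and it exceeds \<open>t k\<close> by at least
  1/2.\<close>

lemma fista_stepsize:
  assumes "t 1 = 1" "\<And>k. k \<ge> 1 \<Longrightarrow> t (k + 1) = (1 + sqrt (1 + 4 * (t k)\<^sup>2)) / 2" "k \<ge> 1"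
  shows "t k \<ge> (real k + 1) / 2" and "t (k + 1) * (t (k + 1) - 1) = (t k)\<^sup>2"
proof -
  show "t k \<ge> (real k + 1) / 2"
    using assms(3)
  proof (induction k rule: nat_induct_at_least)
    case (Suc n)
    have "2 * t n \<le> sqrt (1 + 4 * (t n)\<^sup>2)" by (rule real_le_rsqrt) (simp add: power2_eq_square)
    then show ?case using Suc assms(2)[of n] by simp
  qed (use assms(1) in simp)
  show "t (k + 1) * (t (k + 1) - 1) = (t k)\<^sup>2"
    unfolding assms(2)[OF assms(3)] using real_sqrt_pow2[of "1 + 4 * (t k)\<^sup>2"]
    by (simp add: field_simps power2_eq_square)
qed

section \<open>Merit estimates along the iterates and accumulation points\<close>

context
  fixes f :: "'m::finite \<Rightarrow> 'a::euclidean_space \<Rightarrow> real"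
    and df :: "'m \<Rightarrow> 'a \<Rightarrow> 'a" and g :: "'m \<Rightarrow> 'a \<Rightarrow> ereal"
    and l :: real and x0 :: 'a and x y z :: "nat \<Rightarrow> 'a" and t :: "nat \<Rightarrow> real"
  assumes f_convex: "\<And>i. convex_on UNIV (f i)"
    and f_grad: "\<And>i u. GDERIV (f i) u :> df i u"
    and df_lipschitz: "\<And>i. l-lipschitz_on UNIV (df i)"
    and l_pos: "l > 0"
    and g_closed: "\<And>i. closed_fun (g i)"
    and g_proper: "\<And>i. proper_fun (g i)"
    and g_convex: "\<And>i. convex_fun (g i)"
    and x0_dom: "x0 \<in> effective_dom (composite f g)"
    and alg: "mfista f df g l x0 x y z t"
begin

lemma mfista_start: "x 0 = x0" "y 1 = x0" "t 1 = 1"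
  using alg unfolding mfista_def by auto

lemma mfista_step:
  assumes "k \<ge> 1"
  shows "z k = subproblem_sol f df g l (x (k - 1)) (y k)"
    and "x k = (if (MAX i. composite f g (x (k - 1)) i - composite f g (z k) i) \<ge> 0
               then z k else x (k - 1))"
    and "t (k + 1) = (1 + sqrt (1 + 4 * (t k)\<^sup>2)) / 2"
    and "y (k + 1) = x k + (t k / t (k + 1)) *\<^sub>R (z k - x k)
                        + ((t k - 1) / t (k + 1)) *\<^sub>R (x k - x (k - 1))"
  using alg assms unfolding mfista_def by blast+

lemmas prox_facts = f_convex f_grad df_lipschitz l_pos g_closed g_proper g_convex

lemma mfista_x_in_dom: "x k \<in> effective_dom (composite f g)"
proof (induction k)
  case (Suc k)
  have "z (Suc k) \<in> effective_dom (composite f g)"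
    using subproblem_sol_in_dom[OF prox_facts Suc] mfista_step(1)[of "Suc k"] by simp
  then show ?case using Suc mfista_step(2)[of "Suc k"] by auto
qed (simp add: mfista_start x0_dom)

lemma mfista_z_in_dom:
  assumes "k \<ge> 1"
  shows "z k \<in> effective_dom (composite f g)"
  using subproblem_sol_in_dom[OF prox_facts mfista_x_in_dom] mfista_step(1)[OF assms] by simp

definition fval :: "'a \<Rightarrow> 'm \<Rightarrow> real" where
  "fval u i = real_of_ereal (composite f g u i)"

text \<open>This is \<open>\<sigma>\<^sub>k(u)\<close>; for \<open>u\<close> in the domain it is
  positive exactly when \<open>u\<close> improves on \<open>x k\<close> in every component.\<close>

definition merit :: "'a \<Rightarrow> nat \<Rightarrow> real" where
  "merit u k = (MIN i. fval (x k) i - fval u i)"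

lemma merit_le_add_Max:
  assumes "k \<ge> 1"
  shows "merit u k \<le> merit u (k - 1) + (MAX i. fval (z k) i - fval (x (k - 1)) i)"
proof -
  let ?M = "MAX i. fval (z k) i - fval (x (k - 1)) i"
  have M: "fval (z k) i - fval (x (k - 1)) i \<le> ?M" for i by (rule Max_ge) auto
  obtain j where j: "merit u (k - 1) = fval (x (k - 1)) j - fval u j"
    unfolding merit_def using Min_range_attained by blast
  have "merit u k \<le> fval (x k) j - fval u j" unfolding merit_def by (rule Min_le) auto
  also have "\<dots> \<le> fval (x (k - 1)) j + ?M - fval u j"
  \<comment> \<open>Splitting on this equation instead of the test: if it fails, \<open>z k\<close>
    was certainly rejected.\<close>
  proof (cases "x k = z k")
    case True
    show ?thesis unfolding True using M[of j] by linarith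
  next
    case False
    then have x: "x k = x (k - 1)"
      and neg: "(MAX i. composite f g (x (k - 1)) i - composite f g (z k) i) < 0"
      using mfista_step(2)[OF assms] by (metis not_le)+
    from neg have "composite f g (x (k - 1)) j - composite f g (z k) j < 0"
      by (simp add: Max_less_iff)
    then have "ereal (fval (x (k - 1)) j) - ereal (fval (z k) j) < 0"
      unfolding fval_def
      using effective_domD(1)[OF g_proper mfista_x_in_dom[of "k - 1"], of j]
        effective_domD(1)[OF g_proper mfista_z_in_dom[OF assms], of j] by simp
    then have "fval (x (k - 1)) j < fval (z k) j" by simp
    then have "?M \<ge> 0" using M[of j] by linarith
    then show ?thesis using x by simp
  qed
  finally show ?thesis using j by simp
qed

text \<open>The decrease inequality is used at \<open>u\<close>, where the maximum on the right
  cancels \<open>merit u (k - 1)\<close>, and at \<open>x (k - 1)\<close>, where that maximum is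
  0.\<close>

lemma merit_step:
  assumes k: "k \<ge> 1" and u: "u \<in> effective_dom (composite f g)"
  shows "merit u k \<le> l / 2 * ((norm (u - y k))\<^sup>2 - (norm (u - z k))\<^sup>2)"
    and "merit u k - merit u (k - 1)
       \<le> l / 2 * ((norm (x (k - 1) - y k))\<^sup>2 - (norm (x (k - 1) - z k))\<^sup>2)"
proof -
  let ?M = "MAX i. fval (z k) i - fval (x (k - 1)) i"
  have dec: "?M + l / 2 * (norm (v - z k))\<^sup>2
      \<le> (MAX i. fval v i - fval (x (k - 1)) i) + l / 2 * (norm (v - y k))\<^sup>2"
    if "v \<in> effective_dom (composite f g)" for v
    using subproblem_sol_decrease[OF prox_facts mfista_x_in_dom that, of "k - 1" "y k"]
    unfolding fval_def mfista_step(1)[OF k, symmetric] .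
  have "(MAX i. fval u i - fval (x (k - 1)) i) \<le> - merit u (k - 1)"
  proof (intro Max.boundedI)
    fix e assume "e \<in> range (\<lambda>i. fval u i - fval (x (k - 1)) i)"
    then obtain i where e: "e = fval u i - fval (x (k - 1)) i" by blast
    have "merit u (k - 1) \<le> fval (x (k - 1)) i - fval u i" unfolding merit_def by (rule Min_le) auto
    then show "e \<le> - merit u (k - 1)" using e by simp
  qed auto
  then show "merit u k \<le> l / 2 * ((norm (u - y k))\<^sup>2 - (norm (u - z k))\<^sup>2)"
    using dec[OF u] merit_le_add_Max[OF k, of u] unfolding right_diff_distrib by linarith
  show "merit u k - merit u (k - 1)
       \<le> l / 2 * ((norm (x (k - 1) - y k))\<^sup>2 - (norm (x (k - 1) - z k))\<^sup>2)"
    using dec[OF mfista_x_in_dom, of "k - 1"] merit_le_add_Max[OF k, of u] by (simp add: right_diff_distrib)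
qed

lemma stepsize_ge: "k \<ge> 1 \<Longrightarrow> t k \<ge> (real k + 1) / 2"
  using fista_stepsize(1)[of t] mfista_start(3) mfista_step(3) by blast

text \<open>The left side is a potential that does not increase with \<open>k\<close>; keeping the
  squared norm in it is what lets the induction close.\<close>

lemma merit_telescope:
  assumes k: "k \<ge> 1" and u: "u \<in> effective_dom (composite f g)"
  shows "(t k)\<^sup>2 * merit u k + l / 2 * (norm (t k *\<^sub>R z k - (t k - 1) *\<^sub>R x (k - 1) - u))\<^sup>2
    \<le> l / 2 * (norm (u - x0))\<^sup>2"
  using k
proof (induction k rule: nat_induct_at_least)
  case base
  then show ?case
    using merit_step(1)[OF _ u, of 1] mfista_start
    by (simp add: norm_minus_commute right_diff_distrib)
next
  case (Suc k)
  let ?t = "t (Suc k)"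
  have t1: "?t \<ge> 1" using stepsize_ge[of "Suc k"] by simp
  have eq: "?t * (?t - 1) = (t k)\<^sup>2"
    using fista_stepsize(2)[of t k] mfista_start(3) mfista_step(3) Suc.hyps by simp
  have "?t *\<^sub>R y (Suc k) = ?t *\<^sub>R x k + t k *\<^sub>R (z k - x k) + (t k - 1) *\<^sub>R (x k - x (k - 1))"
    using mfista_step(4)[OF Suc.hyps] t1 by (simp add: scaleR_add_right)
  \<comment> \<open>The extrapolation rule is designed for this: the vector built from
    \<open>y (Suc k)\<close> is the one left over from step \<open>k\<close>. Its term in
    \<open>z k - x k\<close> keeps this true after a rejection.\<close>
  then have yk: "?t *\<^sub>R y (Suc k) - (?t - 1) *\<^sub>R x k = t k *\<^sub>R z k - (t k - 1) *\<^sub>R x (k - 1)"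
    by (simp add: algebra_simps)
  let ?m = "merit u (Suc k)"
  \<comment> \<open>Weights \<open>?t * (?t - 1)\<close> and \<open>?t\<close> for the two bounds of
    \<open>merit_step\<close> are those that \<open>fista_identity\<close> combines into one
    difference of squares.\<close>
  have "?t\<^sup>2 * ?m = (t k)\<^sup>2 * merit u k + ?t * (?t - 1) * (?m - merit u k) + ?t * ?m"
    unfolding eq[symmetric] by (simp add: algebra_simps power2_eq_square)
  also have "\<dots> \<le> (t k)\<^sup>2 * merit u k
      + ?t * (?t - 1) * (l / 2 * ((norm (x k - y (Suc k)))\<^sup>2 - (norm (x k - z (Suc k)))\<^sup>2))
      + ?t * (l / 2 * ((norm (u - y (Suc k)))\<^sup>2 - (norm (u - z (Suc k)))\<^sup>2))"
    using merit_step[OF _ u, of "Suc k"] t1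
    by (intro add_mono mult_left_mono order_refl) auto
  also have "\<dots> = (t k)\<^sup>2 * merit u k + l / 2 *
      (?t * (?t - 1) * ((norm (x k - y (Suc k)))\<^sup>2 - (norm (x k - z (Suc k)))\<^sup>2)
       + ?t * ((norm (u - y (Suc k)))\<^sup>2 - (norm (u - z (Suc k)))\<^sup>2))"
    by (simp only: distrib_left mult.assoc mult.left_commute mult.commute add.assoc)
  also have "\<dots> = (t k)\<^sup>2 * merit u k + l / 2 *
      ((norm (t k *\<^sub>R z k - (t k - 1) *\<^sub>R x (k - 1) - u))\<^sup>2
       - (norm (?t *\<^sub>R z (Suc k) - (?t - 1) *\<^sub>R x k - u))\<^sup>2)"
    unfolding fista_identity yk ..
  finally show ?case using Suc.IH by (simp add: right_diff_distrib)
qed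

text \<open>\<open>merit u k\<close> is at most \<open>C / (t k)\<^sup>2\<close> with
  \<open>C\<close> independent of \<open>k\<close>. The bound is one-sided, since the merit is
  negative when \<open>u\<close> is worse than \<open>x k\<close> in some component.\<close>

lemma merit_limit_nonpos:
  assumes u: "u \<in> effective_dom (composite f g)" and e: "e > 0"
  shows "\<forall>\<^sub>F k in sequentially. merit u k < e"
proof -
  define C where "C = l / 2 * (norm (u - x0))\<^sup>2"
  obtain N :: nat where N: "C / e < real N" using reals_Archimedean2 by blast
  have "merit u k < e" if k: "k \<ge> max 3 (4 * N)" for k
  proof (rule ccontr)
    assume "\<not> merit u k < e"
    moreover have "C < (t k)\<^sup>2 * e"
    proof -
      have tk: "t k \<ge> (real k + 1) / 2" using stepsize_ge k by simp
      \<comment> \<open>Linear growth of \<open>(t k)\<^sup>2\<close> suffices here: one factor is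
        bounded below by 1, the other by \<open>(k + 1) / 2\<close>.\<close>
      have "1 * ((real k + 1) / 2) \<le> t k * t k" using tk k by (intro mult_mono) auto
      then have "real N \<le> (t k)\<^sup>2" using k by (simp add: power2_eq_square)
      then have "C / e < (t k)\<^sup>2" using N by linarith
      then show ?thesis using e by (simp add: field_simps)
    qed
    moreover have "(t k)\<^sup>2 * merit u k \<le> C"
    proof -
      have "0 \<le> l / 2 * (norm (t k *\<^sub>R z k - (t k - 1) *\<^sub>R x (k - 1) - u))\<^sup>2"
        using l_pos by simp
      moreover have "k \<ge> 1" using k by simp
      ultimately show ?thesis using merit_telescope[OF _ u] C_def by fastforce
    qed
    moreover have "(t k)\<^sup>2 * e \<le> (t k)\<^sup>2 * merit u k"
      using calculation(1) by (intro mult_left_mono) auto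
    ultimately show False by linarith
  qed
  then show ?thesis unfolding eventually_sequentially by blast
qed

lemma accumulation_point_weakly_pareto:
  assumes "accumulation_point x p"
  shows "p \<in> weakly_pareto (composite f g)"
proof (rule ccontr)
  assume "p \<notin> weakly_pareto (composite f g)"
  then obtain u where u: "\<And>i. composite f g u i < composite f g p i"
    by (auto simp: weakly_pareto_def)
  obtain r where r: "strict_mono r" "(x \<circ> r) \<longlonglongrightarrow> p"
    using assms by (auto simp: accumulation_point_def)
  have udom: "u \<in> effective_dom (composite f g)"
    using u by (auto simp: effective_dom_def) (metis ereal_infty_less(1) less_ereal.simps(2) not_less_iff_gr_or_eq order_less_trans)
  \<comment> \<open>Real levels between the two values are needed because \<open>p\<close> may lie
    outside the domain, with some \<open>F_i(p)\<close> infinite.\<close>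
  have "\<exists>c. composite f g u i < ereal c \<and> ereal c < composite f g p i" for i
    using ereal_dense2[OF u] by blast
  then obtain c where c: "\<And>i. composite f g u i < ereal (c i)" "\<And>i. ereal (c i) < composite f g p i"
    by metis
  have uc: "fval u i < c i" for i
    using c(1)[of i] effective_domD(1)[OF g_proper udom, of i] unfolding fval_def by (metis less_ereal.simps(1))
  define e where "e = (MIN i. c i - fval u i)"
  have "e > 0" unfolding e_def using uc by (simp add: Min_gr_iff)
  have "\<forall>\<^sub>F k in sequentially. \<forall>i. ereal (c i) < composite f g (x (r k)) i"
  proof (rule eventually_all_finite)
    fix i
    have "continuous_on UNIV (f i)"
      using f_grad[of i] unfolding gderiv_def
      by (meson continuous_at_imp_continuous_on has_derivative_continuous)
    then have "closed {v. composite f g v i \<le> ereal (c i)}"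
      unfolding composite_def
      by (intro closed_fun_sublevel closed_fun_add_continuous g_closed)
    \<comment> \<open>Lower semicontinuity at \<open>p\<close>: this open set contains
      \<open>p\<close>, hence eventually the subsequence.\<close>
    then have "open {v. ereal (c i) < composite f g v i}"
      by (simp add: closed_def Collect_neg_eq[symmetric] not_le)
    then have "\<forall>\<^sub>F k in sequentially. (x \<circ> r) k \<in> {v. ereal (c i) < composite f g v i}"
      by (rule topological_tendstoD[OF r(2)]) (simp add: c(2))
    then show "\<forall>\<^sub>F k in sequentially. ereal (c i) < composite f g (x (r k)) i" by simp
  qed
  moreover have "\<forall>\<^sub>F k in sequentially. merit u (r k) < e"
    using merit_limit_nonpos[OF udom \<open>e > 0\<close>] r(1) by (rule eventually_subseq[rotated])
  ultimately have "\<forall>\<^sub>F k in sequentially. False"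
  proof eventually_elim
    case (elim k)
    obtain j where j: "merit u (r k) = fval (x (r k)) j - fval u j"
      unfolding merit_def using Min_range_attained by blast
    have "c j < fval (x (r k)) j"
      using elim(1) effective_domD(1)[OF g_proper mfista_x_in_dom, of "r k" j] unfolding fval_def
      by (metis less_ereal.simps(1))
    moreover have "e \<le> c j - fval u j" unfolding e_def by (rule Min_le) auto
    ultimately show ?case using elim(2) j by linarith
  qed
  then show False by simp
qed

end

theorem corollary3p6:
  fixes f :: "'m::finite \<Rightarrow> real ^ 'n \<Rightarrow> real"
    and df :: "'m \<Rightarrow> real ^ 'n \<Rightarrow> real ^ 'n"
    and g :: "'m \<Rightarrow> real ^ 'n \<Rightarrow> ereal"
    and Lf :: "'m \<Rightarrow> real"
    and F :: "real ^ 'n \<Rightarrow> 'm \<Rightarrow> ereal"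
    and l :: real
    and x0 :: "real ^ 'n"
    and x y z :: "nat \<Rightarrow> real ^ 'n"
    and t :: "nat \<Rightarrow> real"
  assumes f_convex: "\<And>i. convex_on UNIV (f i)"
    and f_grad: "\<And>i u. GDERIV (f i) u :> df i u"
    and df_cont: "\<And>i. continuous_on UNIV (df i)"
    and Lf_pos: "\<And>i. Lf i > 0"
    and df_lipschitz: "\<And>i. (Lf i)-lipschitz_on UNIV (df i)"
    and g_closed: "\<And>i. closed_fun (g i)"
    and g_proper: "\<And>i. proper_fun (g i)"
    and g_convex: "\<And>i. convex_fun (g i)"
    and F_def: "F = composite f g"
    and pareto_nonempty: "weakly_pareto F \<noteq> {}"
    and x0_dom: "x0 \<in> effective_dom F"
    and pareto_below: "\<forall>u \<in> level_set F (F x0). \<exists>xs \<in> weakly_pareto F. F xs \<le> F u"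
    and R_finite: "pareto_radius F x0 < \<infinity>"
    and l_ge: "l \<ge> (MAX i. Lf i)"
    and alg: "mfista f df g l x0 x y z t"
  shows "\<forall>p. accumulation_point x p \<longrightarrow> p \<in> weakly_pareto F"
proof (intro allI impI)
  fix p assume "accumulation_point x p"
  \<comment> \<open>The convergence lemmas work with one Lipschitz constant for all components, so
    each \<open>Lf i\<close> is raised to \<open>l\<close>.\<close>
  have Ll: "Lf i \<le> l" for i
    using l_ge by simp
  then have "l-lipschitz_on UNIV (df i)" for i
    using df_lipschitz[of i] by (auto intro: lipschitz_on_mono)
  moreover have "l > 0" using Ll Lf_pos by (meson order_less_le_trans)
  ultimately show "p \<in> weakly_pareto F"
    using accumulation_point_weakly_pareto[OF f_convex f_grad _ _ g_closed g_proper g_convex _ alg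
        \<open>accumulation_point x p\<close>] x0_dom
    unfolding F_def by blast
qed

end
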